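(* $\mathsf{tJ}(\mathsf{UC}_{\mathbb{N}^{\mathbb{N}}})\equiv_{\mathrm W}\mathsf{T}(\mathsf{UC}_{\mathbb{N}^{\mathbb{N}}})$ and $\mathsf{tJ}(\mathsf{C}_{\mathbb{N}^{\mathbb{N}}})\equiv_{\mathrm W}\mathsf{T}(\mathsf{C}_{\mathbb{N}^{\mathbb{N}}})$.
   Context: A problem is a partial multi-valued function $f:\subseteq\mathbb{N}^{\mathbb{N}}\rightrightarrows\mathbb{N}^{\mathbb{N}}$, with $\mathrm{dom}(f)=\{p: f(p)\ne\emptyset\}$. $f\le_{\mathrm W} g$ means there are partial computable functionals $\Phi:\subseteq\mathbb{N}^{\mathbb{N}}\to\mathbb{N}^{\mathbb{N}}$ and $\Psi:\subseteq\mathbb{N}^{\mathbb{N}}\times\mathbb{N}^{\mathbb{N}}\to\mathbb{N}^{\mathbb{N}}$ such that for every $p\in\mathrm{dom}(f)$: $\Phi(p)\in\mathrm{dom}(g)$ and $\Psi(p,q)\in f(p)$ for every $q\in g(\Phi(p))$. $f\equiv_{\mathrm W} g$ means $f\le_{\mathrm W} g$ and $g\le_{\mathrm W} f$. Finite products of copies of $\mathbb{N}$ and $\mathbb{N}^{\mathbb{N}}$ are identified with $\mathbb{N}^{\mathbb{N}}$ via standard computable codings. $(\Phi_e)_{e\in\mathbb{N}}$ is a fixed standard computable enumeration of the partial computable functionals on $\mathbb{N}^{\mathbb{N}}$; $\Phi_i(p,q)$ means $\Phi_i$ applied to the pair $(p,q)$; $\downarrow$ means defined. Tot-jump: for $e,i\in\mathbb{N}$,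 $p\in\mathbb{N}^{\mathbb{N}}$, $\mathsf{tJ}(f)(e,i,p)=\{\Phi_i(p,q): q\in f(\Phi_e(p))\}$ if $\Phi_e(p)\in\mathrm{dom}(f)$ and $\Phi_i(p,q)\downarrow$ for all $q\in f(\Phi_e(p))$; otherwise $\mathsf{tJ}(f)(e,i,p)=\mathbb{N}^{\mathbb{N}}$. Totalization: $\mathsf{T}f(x)=f(x)$ if $x\in\mathrm{dom}(f)$ and $\mathsf{T}f(x)=\mathbb{N}^{\mathbb{N}}$ otherwise. $\mathsf{C}_{\mathbb{N}^{\mathbb{N}}}$: given the characteristic function (via a fixed computable coding of finite strings by natural numbers) of an ill-founded subtree of $\mathbb{N}^{<\mathbb{N}}$, find an infinite path through it. $\mathsf{UC}_{\mathbb{N}^{\mathbb{N}}}$ is the restriction of $\mathsf{C}_{\mathbb{N}^{\mathbb{N}}}$ to trees with exactly one infinite path. *)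

theory Defs
  imports Main "HOL-Library.Nat_Bijection" "HOL-Library.Sublist"
begin

section \<open>Partial computable functionals on Baire space\<close>

type_synonym baire = "nat \<Rightarrow> nat"

text \<open>
  Programs for the unary partial functions on the natural numbers that are recursive relative
  to an oracle. Functions of several arguments take their arguments packed by the Cantor pairing
  \<^const>\<open>prod_encode\<close>; the identity is \<open>Pairing Fst Snd\<close>.
\<close>

datatype prog =
    Zero
  | Succ
  | Fst
  | Snd
  | Oracle
  | Pairing prog prog
  | Comp prog prog
  | PrimRec prog prog
  | Minimize prog

text \<open>\<open>eval p c x y\<close>: with oracle \<open>p\<close>, program \<open>c\<close> halts on input \<open>x\<close> with output \<open>y\<close>.\<close>

inductive eval :: "baire \<Rightarrow> prog \<Rightarrow> nat \<Rightarrow> nat \<Rightarrow> bool" for p :: baire where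
  eval_Zero: "eval p Zero x 0"
| eval_Succ: "eval p Succ x (Suc x)"
| eval_Fst: "eval p Fst (prod_encode (x, y)) x"
| eval_Snd: "eval p Snd (prod_encode (x, y)) y"
| eval_Oracle: "eval p Oracle x (p x)"
| eval_Pairing: "eval p c x y \<Longrightarrow> eval p d x z \<Longrightarrow> eval p (Pairing c d) x (prod_encode (y, z))"
| eval_Comp: "eval p d x y \<Longrightarrow> eval p c y z \<Longrightarrow> eval p (Comp c d) x z"
| eval_PrimRec_0: "eval p c x y \<Longrightarrow> eval p (PrimRec c d) (prod_encode (x, 0)) y"
| eval_PrimRec_Suc:
    "eval p (PrimRec c d) (prod_encode (x, k)) y \<Longrightarrow>
     eval p d (prod_encode (x, prod_encode (k, y))) z \<Longrightarrow>
     eval p (PrimRec c d) (prod_encode (x, Suc k)) z"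
| eval_Minimize:
    "eval p c (prod_encode (x, k)) 0 \<Longrightarrow>
     \<forall>j<k. \<exists>y. y \<noteq> 0 \<and> eval p c (prod_encode (x, j)) y \<Longrightarrow>
     eval p (Minimize c) x k"

lemma eval_deterministic: "eval p c x y \<Longrightarrow> eval p c x z \<Longrightarrow> y = z"
proof (induction arbitrary: z rule: eval.induct)
  case (eval_Minimize c x k)
  from eval_Minimize.prems obtain
    "eval p c (prod_encode (x, z)) 0" "\<forall>j<z. \<exists>y. y \<noteq> 0 \<and> eval p c (prod_encode (x, j)) y"
    by (cases rule: eval.cases) auto
  then show ?case
    using eval_Minimize.IH by (metis linorder_neqE_nat)
next
  case (eval_PrimRec_0 c x y d)
  from eval_PrimRec_0.prems show ?case
    by (cases rule: eval.cases) (auto dest: eval_PrimRec_0.IH)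
next
  case (eval_PrimRec_Suc c d x k y w)
  from eval_PrimRec_Suc.prems show ?case
    by (cases rule: eval.cases) (auto dest: eval_PrimRec_Suc.IH)
next
  case (eval_Pairing c x y d w)
  from eval_Pairing.prems show ?case
    by (cases rule: eval.cases) (auto dest: eval_Pairing.IH)
next
  case (eval_Comp d x y c w)
  from eval_Comp.prems show ?case
    by (cases rule: eval.cases) (auto dest: eval_Comp.IH)
qed (auto elim: eval.cases)

text \<open>Goedel numbering of programs: every number is the index of a program.\<close>

function prog_of :: "nat \<Rightarrow> prog" where
  "prog_of n =
    (if n = 0 then Zero
     else if n = 1 then Succ
     else if n = 2 then Fst
     else if n = 3 then Snd
     else if n = 4 then Oracle
     else
       let m = (n - 5) div 4;
           a = fst (prod_decode m);
           b = snd (prod_decode m)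
       in if (n - 5) mod 4 = 0 then Pairing (prog_of a) (prog_of b)
          else if (n - 5) mod 4 = 1 then Comp (prog_of a) (prog_of b)
          else if (n - 5) mod 4 = 2 then PrimRec (prog_of a) (prog_of b)
          else Minimize (prog_of m))"
  by auto

lemma prod_decode_le: "fst (prod_decode m) \<le> m" "snd (prod_decode m) \<le> m"
  by (metis le_prod_encode_1 prod.collapse prod_decode_inverse)
     (metis le_prod_encode_2 prod.collapse prod_decode_inverse)

lemma prog_of_termination:
  assumes "n \<noteq> 0"
  shows "(n - 5) div 4 < n" "fst (prod_decode ((n - 5) div 4)) < n"
    "snd (prod_decode ((n - 5) div 4)) < n"
proof -
  show *: "(n - 5) div 4 < n" using assms by linarith
  show "fst (prod_decode ((n - 5) div 4)) < n" "snd (prod_decode ((n - 5) div 4)) < n"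
    using * prod_decode_le le_less_trans by blast+
qed

termination prog_of
  by (relation "measure id") (simp_all add: prog_of_termination)

declare prog_of.simps [simp del]

lemma surj_prog_of: "surj prog_of"
proof -
  have "\<exists>n. prog_of n = c" for c
  proof (induction c)
    case Zero
    show ?case by (rule exI[of _ 0]) (simp add: prog_of.simps)
  next
    case Succ
    show ?case by (rule exI[of _ 1]) (simp add: prog_of.simps)
  next
    case Fst
    show ?case by (rule exI[of _ 2]) (simp add: prog_of.simps)
  next
    case Snd
    show ?case by (rule exI[of _ 3]) (simp add: prog_of.simps)
  next
    case Oracle
    show ?case by (rule exI[of _ 4]) (simp add: prog_of.simps)
  next
    case (Pairing c d)
    then obtain a b where "prog_of a = c" "prog_of b = d" by blast
    then show ?case
      by (intro exI[of _ "4 * prod_encode (a, b) + 5"]) (subst prog_of.simps, simp add: Let_def)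
  next
    case (Comp c d)
    then obtain a b where "prog_of a = c" "prog_of b = d" by blast
    then show ?case
      by (intro exI[of _ "Suc (4 * prod_encode (a, b)) + 5"])
         (subst prog_of.simps, simp add: Let_def mod_Suc div_Suc)
  next
    case (PrimRec c d)
    then obtain a b where "prog_of a = c" "prog_of b = d" by blast
    then show ?case
      by (intro exI[of _ "Suc (Suc (4 * prod_encode (a, b))) + 5"])
         (subst prog_of.simps, simp add: Let_def mod_Suc div_Suc)
  next
    case (Minimize c)
    then obtain a where "prog_of a = c" by blast
    then show ?case
      by (intro exI[of _ "Suc (Suc (Suc (4 * a))) + 5"])
         (subst prog_of.simps, simp add: Let_def mod_Suc div_Suc)
  qed
  then show ?thesis by (metis surjI)
qed

text \<open>
  \<open>Phi e p\<close> is the function computed by the \<open>e\<close>-th program with oracle \<open>p\<close>. It is defined,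
  as a point of Baire space, exactly when this function is total.
\<close>

definition Phi :: "nat \<Rightarrow> baire \<rightharpoonup> baire" where
  "Phi e p =
    (if \<forall>n. \<exists>y. eval p (prog_of e) n y
     then Some (\<lambda>n. THE y. eval p (prog_of e) n y)
     else None)"

lemma Phi_eq_Some_iff: "Phi e p = Some q \<longleftrightarrow> (\<forall>n. eval p (prog_of e) n (q n))"
proof
  assume "Phi e p = Some q"
  then have ex: "\<forall>n. \<exists>y. eval p (prog_of e) n y" and q: "q = (\<lambda>n. THE y. eval p (prog_of e) n y)"
    by (auto simp: Phi_def split: if_splits)
  show "\<forall>n. eval p (prog_of e) n (q n)"
    unfolding q using ex eval_deterministic by (metis (mono_tags, lifting) theI)
next
  assume *: "\<forall>n. eval p (prog_of e) n (q n)"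
  then have "(\<lambda>n. THE y. eval p (prog_of e) n y) = q"
    by (intro ext the_equality) (auto intro: eval_deterministic)
  with * show "Phi e p = Some q" by (auto simp: Phi_def)
qed

definition partial_computable :: "(baire \<rightharpoonup> baire) \<Rightarrow> bool" where
  "partial_computable F \<longleftrightarrow> (\<exists>e. F = Phi e)"


section \<open>Codings of finite products\<close>

definition pair_baire :: "baire \<Rightarrow> baire \<Rightarrow> baire" where
  "pair_baire p q = (\<lambda>n. if even n then p (n div 2) else q (n div 2))"

definition triple_baire :: "nat \<Rightarrow> nat \<Rightarrow> baire \<Rightarrow> baire" where
  "triple_baire e i p = case_nat e (case_nat i p)"

lemma bij_pair_baire: "bij (\<lambda>(p, q). pair_baire p q)"
proof (rule o_bij)
  show "(\<lambda>x. (\<lambda>n. x (2 * n), \<lambda>n. x (Suc (2 * n)))) \<circ> (\<lambda>(p, q). pair_baire p q) = id"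
    by (auto simp: fun_eq_iff pair_baire_def)
  show "(\<lambda>(p, q). pair_baire p q) \<circ> (\<lambda>x. (\<lambda>n. x (2 * n), \<lambda>n. x (Suc (2 * n)))) = id"
    by (auto simp: fun_eq_iff pair_baire_def)
qed

lemma bij_triple_baire: "bij (\<lambda>(e, i, p). triple_baire e i p)"
proof (rule o_bij)
  show "(\<lambda>x. (x 0, x 1, \<lambda>n. x (Suc (Suc n)))) \<circ> (\<lambda>(e, i, p). triple_baire e i p) = id"
    by (auto simp: fun_eq_iff triple_baire_def)
  show "(\<lambda>(e, i, p). triple_baire e i p) \<circ> (\<lambda>x. (x 0, x 1, \<lambda>n. x (Suc (Suc n)))) = id"
    by (auto simp: fun_eq_iff triple_baire_def split: nat.split)
qed


section \<open>Problems and Weihrauch reducibility\<close>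

type_synonym problem = "baire \<Rightarrow> baire set"

definition pdom :: "problem \<Rightarrow> baire set" where
  "pdom f = {p. f p \<noteq> {}}"

definition weihrauch_le :: "problem \<Rightarrow> problem \<Rightarrow> bool"  (infix "\<le>\<^sub>W" 50) where
  "f \<le>\<^sub>W g \<longleftrightarrow>
    (\<exists>F G. partial_computable F \<and> partial_computable G \<and>
      (\<forall>p\<in>pdom f. \<exists>x. F p = Some x \<and> x \<in> pdom g \<and>
        (\<forall>q\<in>g x. \<exists>r. G (pair_baire p q) = Some r \<and> r \<in> f p)))"

definition weihrauch_equiv :: "problem \<Rightarrow> problem \<Rightarrow> bool"  (infix "\<equiv>\<^sub>W" 50) where
  "f \<equiv>\<^sub>W g \<longleftrightarrow> f \<le>\<^sub>W g \<and> g \<le>\<^sub>W f"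

definition tot_jump_at :: "problem \<Rightarrow> nat \<Rightarrow> nat \<Rightarrow> baire \<Rightarrow> baire set" where
  "tot_jump_at f e i p =
    (if \<exists>x. Phi e p = Some x \<and> x \<in> pdom f \<and> (\<forall>q\<in>f x. Phi i (pair_baire p q) \<noteq> None)
     then {the (Phi i (pair_baire p q)) | q. q \<in> f (the (Phi e p))}
     else UNIV)"

text \<open>
  The tot-jump as a problem on Baire space. As \<open>triple_baire\<close> is a bijection, every input codes
  exactly one triple.
\<close>

definition tJ :: "problem \<Rightarrow> problem" where
  "tJ f x = tot_jump_at f (x 0) (x 1) (\<lambda>n. x (n + 2))"

lemma tJ_triple_baire: "tJ f (triple_baire e i p) = tot_jump_at f e i p"
  by (simp add: tJ_def triple_baire_def)

definition totalization :: "problem \<Rightarrow> problem" where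
  "totalization f x = (if x \<in> pdom f then f x else UNIV)"


section \<open>Choice on Baire space\<close>

definition is_tree :: "nat list set \<Rightarrow> bool" where
  "is_tree T \<longleftrightarrow> (\<forall>t\<in>T. \<forall>s. prefix s t \<longrightarrow> s \<in> T)"

definition paths :: "nat list set \<Rightarrow> baire set" where
  "paths T = {h. \<forall>n. map h [0..<n] \<in> T}"

definition char_tree :: "nat list set \<Rightarrow> baire" where
  "char_tree T = (\<lambda>n. if list_decode n \<in> T then 1 else 0)"

definition C_Baire :: problem where
  "C_Baire x = {h. \<exists>T. is_tree T \<and> paths T \<noteq> {} \<and> x = char_tree T \<and> h \<in> paths T}"

definition UC_Baire :: problem where
  "UC_Baire x = (if \<exists>!h. h \<in> C_Baire x then C_Baire x else {})"

lemma char_tree_inject: "char_tree S = char_tree T \<longleftrightarrow> S = T"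
proof
  assume *: "char_tree S = char_tree T"
  show "S = T"
  proof (rule set_eqI)
    fix s
    from * have "char_tree S (list_encode s) = char_tree T (list_encode s)" by simp
    then show "s \<in> S \<longleftrightarrow> s \<in> T" by (simp add: char_tree_def split: if_splits)
  qed
qed simp

lemma C_Baire_char_tree: "is_tree T \<Longrightarrow> C_Baire (char_tree T) = paths T"
  by (auto simp: C_Baire_def char_tree_inject)

lemma UC_Baire_char_tree:
  "is_tree T \<Longrightarrow> UC_Baire (char_tree T) = (if \<exists>!h. h \<in> paths T then paths T else {})"
  by (simp add: UC_Baire_def C_Baire_char_tree)

end

theory Submission imports Defs "HOL-Library.More_List" begin

text \<open>
  The reduction of the totalization of \<open>f\<close> to \<open>tJ f\<close> works for every problem: run the tot-jump
  with an index of the identity as the forward functional and an index of the second projection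
  as the backward functional (\<open>totalization_le_tJ\<close>).

  For the converse, an input \<open>u\<close> of \<open>tJ f\<close> consists of indices \<open>e = u 0\<close> and \<open>i = u 1\<close> and a
  point \<open>p\<close>. The difficulty is that \<open>Phi e\<close> and \<open>Phi i\<close> are only partial, while the totalization
  has to be fed with a point of Baire space in all cases. Choice on Baire space absorbs this:
  instead of running the functionals, one asks for evidence that they have been run. From \<open>u\<close> one
  computes a tree whose infinite paths carry simultaneously the values of \<open>x = Phi e p\<close>, a path
  \<open>q\<close> of the tree with characteristic function \<open>x\<close>, the values of \<open>Phi i (pair_baire p q)\<close>, and
  for each of these values a finite certificate of the computation that produced it. Checking a
  certificate is decidable, so the tree is computable, whether or not the functionals are defined
  on the arguments in question. If they are, projecting a path to \<open>q\<close> maps the paths of this tree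
  onto those of the tree given by \<open>x\<close> (\<open>solution_tree_path_sound\<close>, \<open>solution_tree_path_complete\<close>). If the tot-jump takes
  its default value, every answer is correct. In both cases the backward functional just projects
  the given answer to the values of \<open>Phi i (pair_baire p q)\<close>, which never diverges.

  For unique choice the tree must not have more paths than the given one. Therefore a path has to
  carry the least certificate of each value; then it is determined by \<open>q\<close>
  (\<open>solution_tree_path_unique\<close>), so the projection to \<open>q\<close> is a bijection.

  A certificate of \<open>eval r (prog_of c) x y\<close> is a finite set of triples, containing \<open>(c, x, y)\<close>,
  each of which follows from others in the set by one rule of the evaluation relation. The set is
  unordered, yet its members cannot justify each other in a circle, because the premises of a rule
  concern smaller programs, or the same primitive recursion at a smaller argument
  (\<open>self_justified_sound\<close>).
\<close>

section \<open>Computable functions relative to an oracle\<close>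

definition computable :: "(baire \<Rightarrow> nat \<Rightarrow> nat) \<Rightarrow> bool" where
  "computable f \<longleftrightarrow> (\<exists>c. \<forall>p x. eval p c x (f p x))"

text \<open>
  The rules collected in \<open>computable_intros\<close> prove computability by following the syntax of a term
  in an oracle \<open>p\<close> and one number \<open>x\<close>. A binder (recursion or bounded quantification) is handled by
  pairing: its body is again a term in one number, whose components are the old argument and
  the bound variable.
\<close>

named_theorems computable_intros

definition decidable :: "(baire \<Rightarrow> nat \<Rightarrow> bool) \<Rightarrow> bool" where
  "decidable P \<longleftrightarrow> computable (\<lambda>p x. of_bool (P p x))"

abbreviation pfst :: "nat \<Rightarrow> nat" where "pfst n \<equiv> fst (prod_decode n)"
abbreviation psnd :: "nat \<Rightarrow> nat" where "psnd n \<equiv> snd (prod_decode n)"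

lemma computable_oracle_at [computable_intros]:
  assumes "computable f" shows "computable (\<lambda>p x. p (f p x))"
  using assms unfolding computable_def by (metis eval_Oracle eval_Comp)

lemma computable_Suc [computable_intros]:
  assumes "computable f" shows "computable (\<lambda>p x. Suc (f p x))"
  using assms unfolding computable_def by (metis eval_Succ eval_Comp)

lemma eval_Fst_prod_decode: "eval p Fst x (pfst x)"
  by (metis eval_Fst prod.collapse prod_decode_inverse)

lemma eval_Snd_prod_decode: "eval p Snd x (psnd x)"
  by (metis eval_Snd prod.collapse prod_decode_inverse)

lemma computable_pfst [computable_intros]:
  assumes "computable f" shows "computable (\<lambda>p x. pfst (f p x))"
  using assms unfolding computable_def by (metis eval_Fst_prod_decode eval_Comp)

lemma computable_psnd [computable_intros]:
  assumes "computable f" shows "computable (\<lambda>p x. psnd (f p x))"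
  using assms unfolding computable_def by (metis eval_Snd_prod_decode eval_Comp)

lemma computable_prod_encode [computable_intros]:
  assumes "computable f" "computable g"
  shows "computable (\<lambda>p x. prod_encode (f p x, g p x))"
  using assms unfolding computable_def by (metis eval_Pairing)

lemma computable_id [computable_intros]: "computable (\<lambda>p x. x)"
  unfolding computable_def
  by (metis eval_Fst_prod_decode eval_Snd_prod_decode eval_Pairing prod.collapse prod_decode_inverse)

lemma computable_const [computable_intros]: "computable (\<lambda>p x. k)"
proof (induction k)
  case 0
  then show ?case unfolding computable_def by (metis eval_Zero)
qed (rule computable_Suc)

lemma computable_compose:
  assumes "computable f" "computable g"
  shows "computable (\<lambda>p x. f p (g p x))"
  using assms unfolding computable_def by (metis eval_Comp)

text \<open>
  The form in which a fixed family of functions \<open>f p a\<close> is used inside a larger term: computable in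
  both arguments jointly, it may be applied to arbitrary computable arguments.
\<close>

lemma computable_compose2:
  assumes "computable (\<lambda>p z. f p (pfst z) (psnd z))" "computable g" "computable h"
  shows "computable (\<lambda>p x. f p (g p x) (h p x))"
  using computable_compose[OF assms(1) computable_prod_encode[OF assms(2,3)]] by simp

lemma computable_rec_nat [computable_intros]:
  assumes "computable f"
    and "computable (\<lambda>p z. g p (pfst z) (pfst (psnd z)) (psnd (psnd z)))"
    and "computable n"
  shows "computable (\<lambda>p x. rec_nat (f p x) (g p x) (n p x))"
proof -
  obtain c d where c: "\<And>p x. eval p c x (f p x)"
    and d: "\<And>p z. eval p d z (g p (pfst z) (pfst (psnd z)) (psnd (psnd z)))"
    using assms(1,2) unfolding computable_def by metis
  have "eval p (PrimRec c d) (prod_encode (x, k)) (rec_nat (f p x) (g p x) k)" for p x k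
  proof (induction k)
    case 0
    then show ?case using c by (simp add: eval_PrimRec_0)
  next
    case (Suc k)
    then show ?case using d[of p "prod_encode (x, prod_encode (k, rec_nat (f p x) (g p x) k))"]
      by (simp add: eval_PrimRec_Suc)
  qed
  then have "eval p (PrimRec c d) z (rec_nat (f p (pfst z)) (g p (pfst z)) (psnd z))" for p z
    by (metis prod.collapse prod_decode_inverse)
  then have "computable (\<lambda>p z. rec_nat (f p (pfst z)) (g p (pfst z)) (psnd z))"
    unfolding computable_def by blast
  from computable_compose2[OF this computable_id assms(3)] show ?thesis .
qed

lemma computable_If [computable_intros]:
  assumes "decidable P" "computable f" "computable g"
  shows "computable (\<lambda>p x. if P p x then f p x else g p x)"
proof -
  have "computable (\<lambda>p x. rec_nat (g p x) (\<lambda>_ _. f p x) (of_bool (P p x)))"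
    by (intro computable_intros assms(1)[unfolded decidable_def] assms(3)
        computable_compose[OF assms(2)])
  moreover have "rec_nat (g p x) (\<lambda>_ _. f p x) (of_bool (P p x)) = (if P p x then f p x else g p x)"
    for p x by simp
  ultimately show ?thesis by simp
qed

lemma computable_add [computable_intros]:
  assumes "computable f" "computable g"
  shows "computable (\<lambda>p x. f p x + g p x)"
proof -
  have "rec_nat m (\<lambda>_ y. Suc y) n = m + n" for m n by (induction n) auto
  moreover have "computable (\<lambda>p x. rec_nat (f p x) (\<lambda>_ y. Suc y) (g p x))"
    by (intro computable_intros assms)
  ultimately show ?thesis by simp
qed

lemma computable_diff [computable_intros]:
  assumes "computable f" "computable g"
  shows "computable (\<lambda>p x. f p x - g p x)"
proof -
  have pred: "rec_nat 0 (\<lambda>k _. k) n = n - 1" for n by (cases n) auto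
  have "rec_nat m (\<lambda>_ y. rec_nat 0 (\<lambda>k _. k) y) n = m - n" for m n
    by (induction n) (auto simp: pred)
  moreover have "computable (\<lambda>p x. rec_nat (f p x) (\<lambda>_ y. rec_nat 0 (\<lambda>k _. k) y) (g p x))"
    by (intro computable_intros assms)
  ultimately show ?thesis by simp
qed

lemma decidable_nonzero:
  assumes "computable f" shows "decidable (\<lambda>p x. f p x \<noteq> 0)"
proof -
  have "rec_nat 0 (\<lambda>_ _. 1) n = (of_bool (n \<noteq> 0) :: nat)" for n by (cases n) auto
  moreover have "computable (\<lambda>p x. rec_nat 0 (\<lambda>_ _. 1) (f p x))"
    by (intro computable_intros assms)
  ultimately show ?thesis by (simp only: decidable_def)
qed

lemma decidable_Not [computable_intros]:
  assumes "decidable P" shows "decidable (\<lambda>p x. \<not> P p x)"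
proof -
  have "computable (\<lambda>p x. if P p x then 0 else 1)" by (intro computable_intros assms)
  moreover have "(if b then 0 else 1) = (of_bool (\<not> b) :: nat)" for b by simp
  ultimately show ?thesis by (simp only: decidable_def)
qed

lemma decidable_If [computable_intros]:
  assumes "decidable P" "decidable Q" "decidable R"
  shows "decidable (\<lambda>p x. if P p x then Q p x else R p x)"
proof -
  have "computable (\<lambda>p x. if P p x then of_bool (Q p x) else of_bool (R p x))"
    using assms(2,3) by (intro computable_intros assms(1)) (auto simp: decidable_def)
  moreover have "(if a then of_bool b else of_bool c) = (of_bool (if a then b else c) :: nat)"
    for a b c by simp
  ultimately show ?thesis by (simp only: decidable_def)
qed

lemma decidable_const [computable_intros]: "decidable (\<lambda>p x. b)"
  by (simp add: decidable_def computable_const)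

lemma decidable_conj [computable_intros]:
  assumes "decidable P" "decidable Q" shows "decidable (\<lambda>p x. P p x \<and> Q p x)"
proof -
  have "(if a then b else False) \<longleftrightarrow> a \<and> b" for a b by simp
  with decidable_If[OF assms decidable_const[of False]] show ?thesis by (simp only:)
qed

lemma decidable_imp [computable_intros]:
  assumes "decidable P" "decidable Q" shows "decidable (\<lambda>p x. P p x \<longrightarrow> Q p x)"
proof -
  have "(if a then b else True) \<longleftrightarrow> (a \<longrightarrow> b)" for a b by simp
  with decidable_If[OF assms decidable_const[of True]] show ?thesis by (simp only:)
qed

lemma decidable_less [computable_intros]:
  assumes "computable f" "computable g" shows "decidable (\<lambda>p x. f p x < g p x)"
proof -
  have "b - a \<noteq> 0 \<longleftrightarrow> a < b" for a b :: nat by auto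
  with decidable_nonzero[OF computable_diff[OF assms(2,1)]] show ?thesis by (simp only:)
qed

lemma decidable_eq [computable_intros]:
  assumes "computable f" "computable g" shows "decidable (\<lambda>p x. f p x = g p x)"
proof -
  have "decidable (\<lambda>p x. \<not> f p x < g p x \<and> \<not> g p x < f p x)"
    by (intro computable_intros assms)
  moreover have "\<not> a < b \<and> \<not> b < a \<longleftrightarrow> a = b" for a b :: nat by auto
  ultimately show ?thesis by (simp only:)
qed

lemma decidable_ball [computable_intros]:
  assumes "computable b" and "decidable (\<lambda>p z. P p (pfst z) (psnd z))"
  shows "decidable (\<lambda>p x. \<forall>k<b p x. P p x k)"
proof -
  have P: "decidable (\<lambda>p z. P p (pfst z) (pfst (psnd z)))"
  proof -
    have "computable (\<lambda>p x. prod_encode (pfst x, pfst (psnd x)))" by (intro computable_intros)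
    from computable_compose[OF assms(2)[unfolded decidable_def] this] show ?thesis
      by (simp add: decidable_def)
  qed
  have "rec_nat 1 (\<lambda>k y. if Q k then y else 0) n = (of_bool (\<forall>k<n. Q k) :: nat)" for Q n
    by (induction n) (auto simp: less_Suc_eq)
  moreover have "computable (\<lambda>p x. rec_nat 1 (\<lambda>k y. if P p x k then y else 0) (b p x))"
    by (intro computable_intros assms(1) P)
  ultimately show ?thesis by (simp only: decidable_def)
qed

lemma decidable_bex [computable_intros]:
  assumes "computable b" and "decidable (\<lambda>p z. P p (pfst z) (psnd z))"
  shows "decidable (\<lambda>p x. \<exists>k<b p x. P p x k)"
proof -
  have "decidable (\<lambda>p x. \<not> (\<forall>k<b p x. \<not> P p x k))" by (intro computable_intros assms)
  then show ?thesis by simp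
qed

lemma computable_mod [computable_intros]:
  assumes "computable f" "computable g"
  shows "computable (\<lambda>p x. f p x mod g p x)"
proof -
  have "rec_nat 0 (\<lambda>_ r. if Suc r = n then 0 else Suc r) m = m mod n" for m n :: nat
    by (induction m) (auto simp: mod_Suc)
  moreover have "computable (\<lambda>p x. rec_nat 0 (\<lambda>_ r. if Suc r = g p x then 0 else Suc r) (f p x))"
    by (intro computable_intros assms(1) computable_compose[OF assms(2)])
  ultimately show ?thesis by (simp only:)
qed

lemma computable_div [computable_intros]:
  assumes "computable f" "computable g"
  shows "computable (\<lambda>p x. f p x div g p x)"
proof -
  have "rec_nat 0 (\<lambda>k y. if Suc k mod n = 0 then Suc y else y) m = m div n" for m n :: nat
    by (induction m) (auto simp: div_Suc)
  moreover have
    "computable (\<lambda>p x. rec_nat 0 (\<lambda>k y. if Suc k mod g p x = 0 then Suc y else y) (f p x))"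
    by (intro computable_intros assms(1) computable_compose[OF assms(2)])
  ultimately show ?thesis by (simp only:)
qed

lemma computable_power2 [computable_intros]:
  assumes "computable f" shows "computable (\<lambda>p x. 2 ^ f p x)"
proof -
  have "rec_nat 1 (\<lambda>_ y. y + y) n = (2 ^ n :: nat)" for n by (induction n) auto
  moreover have "computable (\<lambda>p x. rec_nat 1 (\<lambda>_ y. y + y) (f p x))"
    by (intro computable_intros assms)
  ultimately show ?thesis by (simp only:)
qed

lemma decidable_even [computable_intros]:
  assumes "computable f" shows "decidable (\<lambda>p x. even (f p x))"
  unfolding even_iff_mod_2_eq_zero by (intro computable_intros assms)

lemma decidable_set_decode [computable_intros]:
  assumes "computable f" "computable g" shows "decidable (\<lambda>p x. f p x \<in> set_decode (g p x))"
  unfolding set_decode_def mem_Collect_eq by (intro computable_intros assms)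

lemma psnd_0: "psnd 0 = 0" and pfst_0: "pfst 0 = 0"
  using prod_decode_le[of 0] by simp_all

text \<open>
  A nonempty list has a code \<open>Suc t\<close> with \<open>t\<close> the code of the pair of its head and tail; as 0 decodes
  to \<open>(0, 0)\<close>, the same formula is right for the empty list, and iterating it needs no case
  distinction. Testing whether the remainder is nonempty and reading off its head then
  give the length and the entries of a coded list.
\<close>

lemma drop_list_decode:
  "drop k (list_decode n) = list_decode (rec_nat n (\<lambda>_ t. psnd (t - 1)) k)"
proof (induction k)
  case (Suc k)
  have "tl (list_decode t) = list_decode (psnd (t - 1))" for t
    by (cases t) (simp_all add: psnd_0 split: prod.split)
  moreover have "drop (Suc k) (list_decode n) = tl (drop k (list_decode n))"
    by (simp only: drop_Suc tl_drop)
  ultimately show ?case using Suc by (simp only: old.nat.rec)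
qed simp

lemma decidable_less_length [computable_intros]:
  assumes "computable f" "computable g"
  shows "decidable (\<lambda>p x. f p x < length (list_decode (g p x)))"
proof -
  have "k < length (list_decode n) \<longleftrightarrow> rec_nat n (\<lambda>_ t. psnd (t - 1)) k \<noteq> 0" for k n
  proof -
    have "k < length (list_decode n) \<longleftrightarrow> drop k (list_decode n) \<noteq> []" by auto
    then show ?thesis unfolding drop_list_decode
      by (metis list_decode.simps(1) list_decode_inverse list_encode.simps(1))
  qed
  moreover have "decidable (\<lambda>p x. rec_nat (g p x) (\<lambda>_ t. psnd (t - 1)) (f p x) \<noteq> 0)"
    by (intro computable_intros assms)
  ultimately show ?thesis by (simp only:)
qed

lemma computable_nth_default [computable_intros]:
  assumes "computable f" "computable g"
  shows "computable (\<lambda>p x. nth_default 0 (list_decode (f p x)) (g p x))"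
proof -
  have "nth_default 0 (list_decode n) k = pfst (rec_nat n (\<lambda>_ t. psnd (t - 1)) k - 1)" for k n
  proof -
    have "nth_default 0 (list_decode n) k = nth_default 0 (drop k (list_decode n)) 0"
      by (auto simp: nth_default_def)
    moreover have "nth_default 0 (list_decode t) 0 = pfst (t - 1)" for t
      by (cases t) (simp_all add: pfst_0 split: prod.split)
    ultimately show ?thesis unfolding drop_list_decode by simp
  qed
  moreover have "computable (\<lambda>p x. pfst (rec_nat (f p x) (\<lambda>_ t. psnd (t - 1)) (g p x) - 1))"
    by (intro computable_intros assms)
  ultimately show ?thesis by (simp only:)
qed

lemma length_list_decode_le: "length (list_decode n) \<le> n"
proof (induction n rule: less_induct)
  case (less n)
  show ?case
  proof (cases n)
    case (Suc m)
    have "psnd m \<le> m" by (rule prod_decode_le)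
    then show ?thesis using less[of "psnd m"] Suc by (auto split: prod.split)
  qed simp
qed

lemma partial_computable_total:
  assumes "computable f" shows "partial_computable (\<lambda>p. Some (f p))"
proof -
  obtain c where c: "\<And>p x. eval p c x (f p x)" using assms by (auto simp: computable_def)
  obtain e where "prog_of e = c" using surj_prog_of by (metis surjD)
  then have "Phi e p = Some (f p)" for p using c by (simp add: Phi_eq_Some_iff)
  then show ?thesis unfolding partial_computable_def by (intro exI[of _ e]) (simp add: fun_eq_iff)
qed

lemma weihrauch_le_totalI:
  assumes "computable F" "computable G"
    and "\<And>p. p \<in> pdom f \<Longrightarrow> F p \<in> pdom g"
    and "\<And>p q. p \<in> pdom f \<Longrightarrow> q \<in> g (F p) \<Longrightarrow> G (pair_baire p q) \<in> f p"
  shows "f \<le>\<^sub>W g"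
  unfolding weihrauch_le_def
  using assms(3,4) partial_computable_total[OF assms(1)] partial_computable_total[OF assms(2)]
  by blast

section \<open>Certificates of computations\<close>

abbreviation fact :: "nat set \<Rightarrow> nat \<Rightarrow> nat \<Rightarrow> nat \<Rightarrow> bool" where
  "fact A c x y \<equiv> prod_encode (c, prod_encode (x, y)) \<in> A"

text \<open>
  Each case mirrors one rule of \<^const>\<open>eval\<close>, with the facts in \<open>A\<close> as the possible premises; the
  cases on \<open>c\<close> are those of \<^const>\<open>prog_of\<close>, so that programs are treated through their indices.
\<close>

definition justified :: "baire \<Rightarrow> nat set \<Rightarrow> nat \<Rightarrow> nat \<Rightarrow> nat \<Rightarrow> bool" where
  "justified r A c x y \<longleftrightarrow>
    (if c = 0 then y = 0
     else if c = 1 then y = Suc x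
     else if c = 2 then y = pfst x
     else if c = 3 then y = psnd x
     else if c = 4 then y = r x
     else if (c - 5) mod 4 = 0 then
       fact A (pfst ((c - 5) div 4)) x (pfst y) \<and> fact A (psnd ((c - 5) div 4)) x (psnd y)
     else if (c - 5) mod 4 = 1 then
       \<exists>z. fact A (psnd ((c - 5) div 4)) x z \<and> fact A (pfst ((c - 5) div 4)) z y
     else if (c - 5) mod 4 = 2 then
       if psnd x = 0 then fact A (pfst ((c - 5) div 4)) (pfst x) y
       else \<exists>z. fact A c (prod_encode (pfst x, psnd x - 1)) z \<and>
         fact A (psnd ((c - 5) div 4)) (prod_encode (pfst x, prod_encode (psnd x - 1, z))) y
     else fact A ((c - 5) div 4) (prod_encode (x, y)) 0 \<and>
       (\<forall>j<y. \<exists>z. z \<noteq> 0 \<and> fact A ((c - 5) div 4) (prod_encode (x, j)) z))"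

definition self_justified :: "baire \<Rightarrow> nat set \<Rightarrow> bool" where
  "self_justified r A \<longleftrightarrow> (\<forall>c x y. fact A c x y \<longrightarrow> justified r A c x y)"

lemma justified_mono:
  assumes "A \<subseteq> B" "justified r A c x y" shows "justified r B c x y"
  using assms(2) unfolding justified_def
  by (auto intro: subsetD[OF assms(1)] split: if_splits)

lemma self_justified_Union:
  assumes "\<And>A. A \<in> F \<Longrightarrow> self_justified r A" shows "self_justified r (\<Union>F)"
  using assms unfolding self_justified_def by (meson Union_iff Union_upper justified_mono)

lemma self_justified_insert:
  assumes "self_justified r A" "justified r A c x y"
  shows "self_justified r (insert (prod_encode (c, prod_encode (x, y))) A)"
  unfolding self_justified_def
proof (intro allI impI)
  fix c' x' y' assume "fact (insert (prod_encode (c, prod_encode (x, y))) A) c' x' y'"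
  then have "justified r A c' x' y'" using assms by (auto simp: self_justified_def)
  then show "justified r (insert (prod_encode (c, prod_encode (x, y))) A) c' x' y'"
    by (rule justified_mono[OF subset_insertI])
qed

lemma prog_of_from_5:
  assumes "5 \<le> c"
  shows "(c - 5) mod 4 = 0 \<Longrightarrow>
      prog_of c = Pairing (prog_of (pfst ((c - 5) div 4))) (prog_of (psnd ((c - 5) div 4)))"
    and "(c - 5) mod 4 = 1 \<Longrightarrow>
      prog_of c = Comp (prog_of (pfst ((c - 5) div 4))) (prog_of (psnd ((c - 5) div 4)))"
    and "(c - 5) mod 4 = 2 \<Longrightarrow>
      prog_of c = PrimRec (prog_of (pfst ((c - 5) div 4))) (prog_of (psnd ((c - 5) div 4)))"
    and "(c - 5) mod 4 = 3 \<Longrightarrow> prog_of c = Minimize (prog_of ((c - 5) div 4))"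
  using assms by (subst prog_of.simps; simp add: Let_def)+

lemma prog_of_below_5:
  "prog_of 0 = Zero" "prog_of (Suc 0) = Succ" "prog_of 2 = Fst" "prog_of 3 = Snd"
  "prog_of 4 = Oracle"
  by (subst prog_of.simps; simp)+

text \<open>
  Induction on the index \<open>c\<close>: every rule refers to subprograms, which have smaller indices, except
  that a primitive recursion also refers to itself at the preceding argument; this is covered by
  an inner induction on that argument.
\<close>

lemma self_justified_sound:
  assumes A: "self_justified r A" and "fact A c x y"
  shows "eval r (prog_of c) x y"
  using assms(2)
proof (induction c arbitrary: x y rule: less_induct)
  case (less c)
  have just: "justified r A c x y" if "fact A c x y" for x y
    using A that by (auto simp: self_justified_def)
  define m where "m = (c - 5) div 4"
  consider "c = 0" | "c = 1" | "c = 2" | "c = 3" | "c = 4" | "5 \<le> c" "(c - 5) mod 4 = 0"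
    | "5 \<le> c" "(c - 5) mod 4 = 1" | "5 \<le> c" "(c - 5) mod 4 = 2" | "5 \<le> c" "(c - 5) mod 4 = 3"
  proof -
    have "c < 5 \<Longrightarrow> c = 0 \<or> c = 1 \<or> c = 2 \<or> c = 3 \<or> c = 4" by arith
    moreover have "k < 4 \<Longrightarrow> k = 0 \<or> k = 1 \<or> k = 2 \<or> k = 3" for k :: nat by arith
    from this[of "(c - 5) mod 4"] have "(c - 5) mod 4 = 0 \<or> (c - 5) mod 4 = 1 \<or>
        (c - 5) mod 4 = 2 \<or> (c - 5) mod 4 = 3" by simp
    ultimately show ?thesis using that not_less by metis
  qed
  then show ?case
  proof cases
    case 6
    note IH = less.IH[OF prog_of_termination(2)] less.IH[OF prog_of_termination(3)]
    from just[OF less.prems] 6 have "fact A (pfst m) x (pfst y)" "fact A (psnd m) x (psnd y)"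
      by (simp_all add: justified_def m_def)
    then have "eval r (prog_of c) x (prod_encode (pfst y, psnd y))"
      unfolding prog_of_from_5(1)[OF 6] using 6 IH by (intro eval_Pairing) (auto simp: m_def)
    then show ?thesis by simp
  next
    case 7
    note IH = less.IH[OF prog_of_termination(2)] less.IH[OF prog_of_termination(3)]
    from just[OF less.prems] 7 obtain z where "fact A (psnd m) x z" "fact A (pfst m) z y"
      by (auto simp: justified_def m_def)
    then show ?thesis
      unfolding prog_of_from_5(2)[OF 7] using 7 IH by (intro eval_Comp[of _ _ _ z]) (auto simp: m_def)
  next
    case 8
    note IH = less.IH[OF prog_of_termination(2)] less.IH[OF prog_of_termination(3)]
    have "eval r (prog_of c) (prod_encode (a, k)) w" if "fact A c (prod_encode (a, k)) w" for a k w
      using that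
    proof (induction k arbitrary: w)
      case 0
      from just[OF 0] 8 have "fact A (pfst m) a w" by (simp add: justified_def m_def)
      then show ?case
        unfolding prog_of_from_5(3)[OF 8] using 8 IH by (intro eval_PrimRec_0) (auto simp: m_def)
    next
      case (Suc k)
      from just[OF Suc.prems] 8 obtain z where z: "fact A c (prod_encode (a, k)) z"
        "fact A (psnd m) (prod_encode (a, prod_encode (k, z))) w"
        by (auto simp: justified_def m_def)
      with Suc.IH[OF z(1)] show ?case
        unfolding prog_of_from_5(3)[OF 8] using 8 IH
        by (intro eval_PrimRec_Suc[of _ _ _ _ _ z]) (auto simp: m_def)
    qed
    from this[of "pfst x" "psnd x" y] less.prems show ?thesis by simp
  next
    case 9
    note IH = less.IH[OF prog_of_termination(1)]
    from just[OF less.prems] 9 have "fact A m (prod_encode (x, y)) 0"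
      and "\<forall>j<y. \<exists>z. z \<noteq> 0 \<and> fact A m (prod_encode (x, j)) z"
      by (simp_all add: justified_def m_def)
    then show ?thesis
      unfolding prog_of_from_5(4)[OF 9] using 9 IH by (intro eval_Minimize) (auto simp: m_def, blast)
  qed (use just[OF less.prems] in \<open>simp_all add: justified_def prog_of_below_5
        eval_Zero eval_Succ eval_Fst_prod_decode eval_Snd_prod_decode eval_Oracle\<close>)
qed

lemma prog_of_inversion:
  shows "prog_of c = Zero \<Longrightarrow> c = 0"
    and "prog_of c = Succ \<Longrightarrow> c = 1"
    and "prog_of c = Fst \<Longrightarrow> c = 2"
    and "prog_of c = Snd \<Longrightarrow> c = 3"
    and "prog_of c = Oracle \<Longrightarrow> c = 4"
    and "prog_of c = Pairing d1 d2 \<Longrightarrow> 5 \<le> c \<and> (c - 5) mod 4 = 0 \<and>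
      prog_of (pfst ((c - 5) div 4)) = d1 \<and> prog_of (psnd ((c - 5) div 4)) = d2"
    and "prog_of c = Comp d1 d2 \<Longrightarrow> 5 \<le> c \<and> (c - 5) mod 4 = 1 \<and>
      prog_of (pfst ((c - 5) div 4)) = d1 \<and> prog_of (psnd ((c - 5) div 4)) = d2"
    and "prog_of c = PrimRec d1 d2 \<Longrightarrow> 5 \<le> c \<and> (c - 5) mod 4 = 2 \<and>
      prog_of (pfst ((c - 5) div 4)) = d1 \<and> prog_of (psnd ((c - 5) div 4)) = d2"
    and "prog_of c = Minimize d \<Longrightarrow> 5 \<le> c \<and> (c - 5) mod 4 = 3 \<and>
      prog_of ((c - 5) div 4) = d"
  by (subst (asm) prog_of.simps, (auto simp: Let_def split: if_splits; linarith))+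

text \<open>
  An evaluation has a finite derivation, and the facts occurring in it form the required set.
  Justification is monotone, so the sets for the premises of a rule can be united and the
  conclusion added.
\<close>

lemma self_justified_complete:
  assumes "eval r d x y" "prog_of c = d"
  shows "\<exists>A. finite A \<and> self_justified r A \<and> fact A c x y"
proof -
  have insertI: "\<exists>A. finite A \<and> self_justified r A \<and> fact A c x y"
    if "finite A" "self_justified r A" "justified r A c x y" for A c x y
    using that by (intro exI[of _ "insert (prod_encode (c, prod_encode (x, y))) A"])
      (simp add: self_justified_insert)
  have empty: "self_justified r {}" by (simp add: self_justified_def)
  show ?thesis
    using assms
  proof (induction arbitrary: c rule: eval.induct)
    case (eval_Zero x)
    then show ?case
      using insertI[OF finite.emptyI empty, of c x 0] prog_of_inversion(1)[of c]
      by (simp add: justified_def)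
  next
    case (eval_Pairing d1 x y d2 z)
    define m where "m = (c - 5) div 4"
    note c = prog_of_inversion(6)[OF eval_Pairing.prems, folded m_def]
    obtain A where A: "finite A" "self_justified r A" "fact A (pfst m) x y"
      using eval_Pairing.IH(1)[of "pfst m"] c by blast
    obtain B where B: "finite B" "self_justified r B" "fact B (psnd m) x z"
      using eval_Pairing.IH(2)[of "psnd m"] c by blast
    show ?case
    proof (rule insertI)
      show "self_justified r (\<Union>{A, B})" using A B by (intro self_justified_Union) auto
      show "justified r (\<Union>{A, B}) c x (prod_encode (y, z))"
        using c A(3) B(3) by (simp add: justified_def m_def)
    qed (use A B in auto)
  next
    case (eval_Comp d2 x y d1 z)
    define m where "m = (c - 5) div 4"
    note c = prog_of_inversion(7)[OF eval_Comp.prems, folded m_def]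
    obtain A where A: "finite A" "self_justified r A" "fact A (psnd m) x y"
      using eval_Comp.IH(1)[of "psnd m"] c by blast
    obtain B where B: "finite B" "self_justified r B" "fact B (pfst m) y z"
      using eval_Comp.IH(2)[of "pfst m"] c by blast
    show ?case
    proof (rule insertI)
      show "self_justified r (\<Union>{A, B})" using A B by (intro self_justified_Union) auto
      show "justified r (\<Union>{A, B}) c x z"
        using c A(3) B(3) by (auto simp: justified_def m_def)
    qed (use A B in auto)
  next
    case (eval_PrimRec_0 d1 x y d2)
    define m where "m = (c - 5) div 4"
    note c = prog_of_inversion(8)[OF eval_PrimRec_0.prems, folded m_def]
    obtain A where A: "finite A" "self_justified r A" "fact A (pfst m) x y"
      using eval_PrimRec_0.IH(1)[of "pfst m"] c by blast
    then show ?case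
      using c by (intro insertI[of A]) (simp_all add: justified_def m_def)
  next
    case (eval_PrimRec_Suc d1 d2 x k y z)
    define m where "m = (c - 5) div 4"
    note c = prog_of_inversion(8)[OF eval_PrimRec_Suc.prems, folded m_def]
    obtain A where A: "finite A" "self_justified r A" "fact A c (prod_encode (x, k)) y"
      using eval_PrimRec_Suc.IH(1)[of c] eval_PrimRec_Suc.prems by blast
    obtain B where B: "finite B" "self_justified r B"
      "fact B (psnd m) (prod_encode (x, prod_encode (k, y))) z"
      using eval_PrimRec_Suc.IH(2)[of "psnd m"] c by blast
    show ?case
    proof (rule insertI)
      show "self_justified r (\<Union>{A, B})" using A B by (intro self_justified_Union) auto
      show "justified r (\<Union>{A, B}) c (prod_encode (x, Suc k)) z"
        using c A(3) B(3) by (auto simp: justified_def m_def)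
    qed (use A B in auto)
  next
    case (eval_Minimize d x k)
    define m where "m = (c - 5) div 4"
    note c = prog_of_inversion(9)[OF eval_Minimize.prems, folded m_def]
    obtain A where A: "finite A" "self_justified r A" "fact A m (prod_encode (x, k)) 0"
      using eval_Minimize.IH(1)[of "m"] c by blast
    have "\<forall>j<k. \<exists>B. finite B \<and> self_justified r B \<and> (\<exists>y. y \<noteq> 0 \<and> fact B m (prod_encode (x, j)) y)"
      using eval_Minimize.IH(2) c by metis
    then obtain B where B: "\<forall>j<k. finite (B j) \<and> self_justified r (B j) \<and>
        (\<exists>y. y \<noteq> 0 \<and> fact (B j) m (prod_encode (x, j)) y)"
      by metis
    let ?U = "\<Union>(insert A (B ` {..<k}))"
    show ?case
    proof (rule insertI)
      show "self_justified r ?U" using A B by (intro self_justified_Union) auto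
      have "\<exists>y. y \<noteq> 0 \<and> fact ?U m (prod_encode (x, j)) y" if "j < k" for j
      proof -
        obtain y where "y \<noteq> 0" "fact (B j) m (prod_encode (x, j)) y" using B \<open>j < k\<close> by blast
        moreover have "B j \<subseteq> ?U" using \<open>j < k\<close> by auto
        ultimately show ?thesis by (meson subsetD)
      qed
      then show "justified r ?U c x k"
        using c A(3) by (simp add: justified_def m_def)
      show "finite ?U" using A B by auto
    qed
  qed (drule prog_of_inversion, rule insertI[OF finite.emptyI empty], simp add: justified_def)+
qed

text \<open>
  Finite sets of facts are coded by the numbers whose binary digits are their indicator functions.
\<close>

definition certifies :: "baire \<Rightarrow> nat \<Rightarrow> nat \<Rightarrow> nat \<Rightarrow> nat \<Rightarrow> bool" where
  "certifies r e n y W \<longleftrightarrow> self_justified r (set_decode W) \<and> fact (set_decode W) e n y"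

definition least_certificate :: "baire \<Rightarrow> nat \<Rightarrow> nat \<Rightarrow> nat \<Rightarrow> nat \<Rightarrow> bool" where
  "least_certificate r e n y W \<longleftrightarrow>
    certifies r e n y W \<and> (\<forall>V<W. \<not> certifies r e n y V)"

lemma eval_iff_certifies: "eval r (prog_of e) n y \<longleftrightarrow> (\<exists>W. certifies r e n y W)"
proof
  assume "eval r (prog_of e) n y"
  from self_justified_complete[OF this refl] obtain A
    where "finite A" "self_justified r A" "fact A e n y" by blast
  then have "certifies r e n y (set_encode A)" by (simp add: certifies_def set_encode_inverse)
  then show "\<exists>W. certifies r e n y W" ..
qed (auto simp: certifies_def dest: self_justified_sound)

lemma eval_iff_least_certificate:
  "eval r (prog_of e) n y \<longleftrightarrow> (\<exists>W. least_certificate r e n y W)"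
  unfolding eval_iff_certifies least_certificate_def by (metis LeastI not_less_Least)

lemma least_certificate_unique:
  "least_certificate r e n y V \<Longrightarrow> least_certificate r e n y W \<Longrightarrow> V = W"
  unfolding least_certificate_def by (meson linorder_neqE_nat)

lemma set_decode_less: "a \<in> set_decode W \<Longrightarrow> a < W"
proof -
  assume "a \<in> set_decode W"
  then have "W div 2 ^ a \<noteq> 0" unfolding set_decode_def by (metis even_zero mem_Collect_eq)
  then have "2 ^ a \<le> W" by (simp add: div_eq_0_iff)
  then show "a < W" by (meson less_exp less_le_trans)
qed

text \<open>
  An element of the set coded by \<open>W\<close> is smaller than \<open>W\<close>, and so are the components of a coded fact.
  Hence checking the certificate \<open>W\<close> needs only bounded searches, and only the oracle values at
  arguments below \<open>W\<close>.
\<close>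

lemma fact_less:
  assumes "fact (set_decode W) c x y" shows "c < W" "x < W" "y < W"
  using set_decode_less[OF assms] le_prod_encode_1[of c "prod_encode (x, y)"]
    le_prod_encode_2[of "prod_encode (x, y)" c] le_prod_encode_1[of x y] le_prod_encode_2[of y x]
  by linarith+

lemma self_justified_cong:
  assumes "\<And>x. x < W \<Longrightarrow> r x = r' x"
  shows "self_justified r (set_decode W) \<longleftrightarrow> self_justified r' (set_decode W)"
proof -
  have "justified r (set_decode W) c x y \<longleftrightarrow> justified r' (set_decode W) c x y"
    if "fact (set_decode W) c x y" for c x y
    using assms[OF fact_less(2)[OF that]] by (simp add: justified_def)
  then show ?thesis by (auto simp: self_justified_def)
qed

lemma least_certificate_cong:
  assumes "\<And>x. x < W \<Longrightarrow> r x = r' x"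
  shows "least_certificate r e n y W \<longleftrightarrow> least_certificate r' e n y W"
proof -
  have "certifies r e n y V \<longleftrightarrow> certifies r' e n y V" if "V \<le> W" for V
    unfolding certifies_def using self_justified_cong[of V r r'] assms that by simp
  then show ?thesis unfolding least_certificate_def by simp
qed

text \<open>The quantifiers in the check of a certificate are bounded, which makes it decidable.\<close>

lemma self_justified_set_decode_bounded:
  "self_justified r (set_decode W) \<longleftrightarrow>
    (\<forall>c<W. \<forall>x<W. \<forall>y<W. fact (set_decode W) c x y \<longrightarrow>
    (if c = 0 then y = 0
     else if c = 1 then y = Suc x
     else if c = 2 then y = pfst x
     else if c = 3 then y = psnd x
     else if c = 4 then y = r x
     else if (c - 5) mod 4 = 0 then
       fact (set_decode W) (pfst ((c - 5) div 4)) x (pfst y) \<and>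
       fact (set_decode W) (psnd ((c - 5) div 4)) x (psnd y)
     else if (c - 5) mod 4 = 1 then
       \<exists>z<W. fact (set_decode W) (psnd ((c - 5) div 4)) x z \<and>
         fact (set_decode W) (pfst ((c - 5) div 4)) z y
     else if (c - 5) mod 4 = 2 then
       if psnd x = 0 then fact (set_decode W) (pfst ((c - 5) div 4)) (pfst x) y
       else \<exists>z<W. fact (set_decode W) c (prod_encode (pfst x, psnd x - 1)) z \<and>
         fact (set_decode W) (psnd ((c - 5) div 4))
           (prod_encode (pfst x, prod_encode (psnd x - 1, z))) y
     else fact (set_decode W) ((c - 5) div 4) (prod_encode (x, y)) 0 \<and>
       (\<forall>j<y. \<exists>z<W. z \<noteq> 0 \<and> fact (set_decode W) ((c - 5) div 4) (prod_encode (x, j)) z)))"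
proof -
  have bex: "(\<exists>z. fact (set_decode W) c x z \<and> P z) \<longleftrightarrow>
      (\<exists>z<W. fact (set_decode W) c x z \<and> P z)"
    "(\<exists>z. z \<noteq> 0 \<and> fact (set_decode W) c x z) \<longleftrightarrow>
      (\<exists>z<W. z \<noteq> 0 \<and> fact (set_decode W) c x z)" for c x P
    by (blast dest: fact_less(3))+
  have ball: "(\<forall>c x y. fact (set_decode W) c x y \<longrightarrow> P c x y) \<longleftrightarrow>
      (\<forall>c<W. \<forall>x<W. \<forall>y<W. fact (set_decode W) c x y \<longrightarrow> P c x y)" for P
    by (blast dest: fact_less)
  show ?thesis
    unfolding self_justified_def justified_def bex ball ..
qed

text \<open>
  The oracle \<open>r p x\<close> of the checked computation may itself depend on the argument \<open>x\<close>. This is needed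
  below, where part of the oracle is read off a coded finite sequence.
\<close>

lemma decidable_least_certificate:
  assumes r: "computable (\<lambda>p z. r p (pfst z) (psnd z))"
    and "computable e" "computable n" "computable y" "computable W"
  shows "decidable (\<lambda>p x. least_certificate (r p x) (e p x) (n p x) (y p x) (W p x))"
proof -
  note r' = computable_compose2[of r, OF r]
  have certifies: "decidable (\<lambda>p x. certifies (r p (f p x)) (e p x) (n p x) (y p x) (W p x))"
    if "computable f" "computable e" "computable n" "computable y" "computable W" for f e n y W
    unfolding certifies_def self_justified_set_decode_bounded
    by (intro computable_intros r' that computable_compose[OF that(1)]
      computable_compose[OF that(5)])
  show ?thesis
    unfolding least_certificate_def
    by (intro computable_intros certifies assms(2-5) computable_compose[OF assms(2)]
      computable_compose[OF assms(3)] computable_compose[OF assms(4)])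
qed

section \<open>The tree of certified solutions\<close>

text \<open>
  The entry at position \<open>n\<close> of a path codes five numbers: the value at \<open>n\<close> of the first functional
  with its certificate, the value at \<open>n\<close> of the solution \<open>q\<close>, and the value at \<open>n\<close> of the second
  functional with its certificate.
\<close>

abbreviation "value_at t \<equiv> pfst t"
abbreviation "value_cert t \<equiv> pfst (psnd t)"
abbreviation "solution_at t \<equiv> pfst (psnd (psnd t))"
abbreviation "output_at t \<equiv> pfst (psnd (psnd (psnd t)))"
abbreviation "output_cert t \<equiv> psnd (psnd (psnd (psnd t)))"

text \<open>
  What a sequence must satisfy, as far as this can be seen from its first \<open>m\<close> entries. The
  second condition says that an initial segment of \<open>q\<close> with code \<open>n\<close> belongs to the tree computed
  by the first functional; its entries are available since a list is no longer than its code.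
  The oracle of the second computation contains \<open>q\<close>, so its certificate is inspected only if it
  is less than \<open>m\<close>: then all its oracle questions are answered by entries below \<open>m\<close>. The oracle
  of the first computation is part of the input, so its certificate can be inspected at once.
\<close>

definition consistent_upto :: "baire \<Rightarrow> baire \<Rightarrow> nat \<Rightarrow> bool" where
  "consistent_upto u h m \<longleftrightarrow> (\<forall>n<m.
     least_certificate (\<lambda>k. u (k + 2)) (u 0) n (value_at (h n)) (value_cert (h n)) \<and>
     ((\<forall>l<n. l < length (list_decode n) \<longrightarrow>
         nth_default 0 (list_decode n) l = solution_at (h l)) \<longrightarrow> value_at (h n) = 1) \<and>
     (output_cert (h n) < m \<longrightarrow>
       least_certificate (pair_baire (\<lambda>k. u (k + 2)) (\<lambda>k. solution_at (h k))) (u 1) n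
         (output_at (h n)) (output_cert (h n))))"

definition solution_tree :: "baire \<Rightarrow> nat list set" where
  "solution_tree u =
    {s. \<forall>m<Suc (length s). consistent_upto u (nth_default 0 s) m}"

text \<open>
  This locality makes the nodes closed under prefixes, and makes the padding of a node by zeros
  harmless.
\<close>

lemma consistent_upto_cong:
  assumes "\<And>k. k < m \<Longrightarrow> h k = h' k"
  shows "consistent_upto u h m \<longleftrightarrow> consistent_upto u h' m"
proof -
  have "least_certificate (pair_baire p (\<lambda>k. solution_at (h k))) e n y W \<longleftrightarrow>
      least_certificate (pair_baire p (\<lambda>k. solution_at (h' k))) e n y W"
    if "W < m" for p e n y W
    using that assms by (intro least_certificate_cong) (auto simp: pair_baire_def)
  then show ?thesis
    unfolding consistent_upto_def using assms by (intro all_cong) auto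
qed

lemma is_tree_solution_tree: "is_tree (solution_tree u)"
  unfolding is_tree_def
proof (intro ballI allI impI)
  fix t s assume t: "t \<in> solution_tree u" and "prefix s t"
  then obtain t' where t': "t = s @ t'" by (auto simp: prefix_def)
  have "consistent_upto u (nth_default 0 s) m" if "m < Suc (length s)" for m
  proof -
    have "consistent_upto u (nth_default 0 t) m" using t that by (simp add: solution_tree_def t')
    then show ?thesis
      using that by (subst consistent_upto_cong[of _ _ "nth_default 0 t"])
        (auto simp: t' nth_default_append nth_default_nth)
  qed
  then show "s \<in> solution_tree u" by (simp add: solution_tree_def)
qed

lemma paths_solution_tree: "paths (solution_tree u) = {h. \<forall>m. consistent_upto u h m}"
proof -
  have "consistent_upto u (nth_default 0 (map h [0..<n])) m \<longleftrightarrow> consistent_upto u h m"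
    if "m \<le> n" for h n m
    using that by (intro consistent_upto_cong) (simp add: nth_default_def)
  then show ?thesis
    unfolding paths_def solution_tree_def by (auto simp: less_Suc_eq_le)
qed

lemma computable_pair_baire:
  assumes p: "computable (\<lambda>u z. p u (pfst z) (psnd z))"
    and q: "computable (\<lambda>u z. q u (pfst z) (psnd z))" and f: "computable f"
  shows "computable (\<lambda>u x. pair_baire (p u x) (q u x) (f u x))"
  unfolding pair_baire_def
  by (intro computable_intros computable_compose2[of p, OF p] computable_compose2[of q, OF q] f)

lemma decidable_consistent_upto:
  assumes h: "computable (\<lambda>u z. h u (pfst z) (psnd z))" and m: "computable m"
  shows "decidable (\<lambda>u x. consistent_upto u (h u x) (m u x))"
  unfolding consistent_upto_def
  by (intro computable_intros decidable_least_certificate computable_pair_baire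
    computable_compose2[of h, OF h] m computable_compose[OF m])

lemma computable_solution_tree: "computable (\<lambda>u. char_tree (solution_tree u))"
proof -
  have "decidable (\<lambda>u N. \<forall>m<Suc N. (m \<noteq> 0 \<longrightarrow> m - 1 < length (list_decode N)) \<longrightarrow>
      consistent_upto u (nth_default 0 (list_decode N)) m)"
    by (intro computable_intros decidable_consistent_upto)
  moreover have "list_decode N \<in> solution_tree u \<longleftrightarrow>
      (\<forall>m<Suc N. (m \<noteq> 0 \<longrightarrow> m - 1 < length (list_decode N)) \<longrightarrow>
        consistent_upto u (nth_default 0 (list_decode N)) m)" for N u
  proof -
    have "m < Suc (length (list_decode N)) \<longleftrightarrow>
        m < Suc N \<and> (m \<noteq> 0 \<longrightarrow> m - 1 < length (list_decode N))" for m
      using length_list_decode_le[of N] by auto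
    then show ?thesis unfolding solution_tree_def by auto
  qed
  ultimately have "decidable (\<lambda>u N. list_decode N \<in> solution_tree u)" by (simp only:)
  then show ?thesis
    unfolding char_tree_def by (intro computable_intros)
qed

text \<open>On an infinite path every certificate is eventually inspected, so the side condition disappears.\<close>

lemma mem_paths_solution_tree:
  fixes u :: baire
  defines "p \<equiv> \<lambda>k. u (k + 2)"
  shows "h \<in> paths (solution_tree u) \<longleftrightarrow> (\<forall>n.
    least_certificate p (u 0) n (value_at (h n)) (value_cert (h n)) \<and>
    (list_decode n = map (\<lambda>l. solution_at (h l)) [0..<length (list_decode n)] \<longrightarrow>
      value_at (h n) = 1) \<and>
    least_certificate (pair_baire p (\<lambda>k. solution_at (h k))) (u 1) n
      (output_at (h n)) (output_cert (h n)))" (is "_ \<longleftrightarrow> (\<forall>n. ?A n \<and> ?B n \<and> ?C n)")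
proof -
  have B: "((\<forall>l<n. l < length (list_decode n) \<longrightarrow>
         nth_default 0 (list_decode n) l = solution_at (h l)) \<longrightarrow> value_at (h n) = 1) \<longleftrightarrow> ?B n" for n
  proof -
    have "(\<forall>l<n. l < length L \<longrightarrow> nth_default 0 L l = g l) \<longleftrightarrow> L = map g [0..<length L]"
      if "length L \<le> n" for L :: "nat list" and g
      using that by (subst list_eq_iff_nth_eq) (auto simp: nth_default_nth)
    from this[OF length_list_decode_le] show ?thesis by (simp only:)
  qed
  have eq: "consistent_upto u h m \<longleftrightarrow>
      (\<forall>n<m. ?A n \<and> ?B n \<and> (output_cert (h n) < m \<longrightarrow> ?C n))" for m
    unfolding consistent_upto_def B p_def ..
  \<comment> \<open>Take a level above both the position and the certificate found there.\<close>
  have "?A n \<and> ?B n \<and> ?C n" if "\<forall>m. consistent_upto u h m" for n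
    using that[rule_format, of "Suc (max n (output_cert (h n)))"] unfolding eq
    by (auto simp: less_Suc_eq_le)
  then show ?thesis
    unfolding paths_solution_tree mem_Collect_eq eq by blast
qed

lemma mem_paths_iff_char_tree:
  "q \<in> paths T \<longleftrightarrow> (\<forall>k. char_tree T (list_encode (map q [0..<k])) = 1)"
  by (auto simp: paths_def char_tree_def)

lemma solution_tree_path_sound:
  assumes h: "h \<in> paths (solution_tree u)"
    and T: "Phi (u 0) (\<lambda>k. u (k + 2)) = Some (char_tree T)"
  shows "(\<lambda>n. solution_at (h n)) \<in> paths T"
    and "Phi (u 1) (pair_baire (\<lambda>k. u (k + 2)) (\<lambda>n. solution_at (h n))) =
      Some (\<lambda>n. output_at (h n))"
proof -
  note h = h[unfolded mem_paths_solution_tree, rule_format]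
  show "Phi (u 1) (pair_baire (\<lambda>k. u (k + 2)) (\<lambda>n. solution_at (h n))) =
      Some (\<lambda>n. output_at (h n))"
    unfolding Phi_eq_Some_iff eval_iff_least_certificate using h by blast
  have "Phi (u 0) (\<lambda>k. u (k + 2)) = Some (\<lambda>n. value_at (h n))"
    unfolding Phi_eq_Some_iff eval_iff_least_certificate using h by blast
  with T have "char_tree T = (\<lambda>n. value_at (h n))" by simp
  then have "char_tree T n = value_at (h n)" for n by (rule fun_cong)
  moreover have "value_at (h (list_encode (map (\<lambda>n. solution_at (h n)) [0..<k]))) = 1" for k
    using h[of "list_encode (map (\<lambda>n. solution_at (h n)) [0..<k])"] by simp
  ultimately show "(\<lambda>n. solution_at (h n)) \<in> paths T"
    unfolding mem_paths_iff_char_tree by simp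
qed

lemma solution_tree_path_complete:
  assumes q: "q \<in> paths T"
    and T: "Phi (u 0) (\<lambda>k. u (k + 2)) = Some (char_tree T)"
    and y: "Phi (u 1) (pair_baire (\<lambda>k. u (k + 2)) q) = Some y"
  shows "\<exists>h\<in>paths (solution_tree u). (\<lambda>n. solution_at (h n)) = q"
proof -
  obtain w where w: "\<And>n. least_certificate (\<lambda>k. u (k + 2)) (u 0) n (char_tree T n) (w n)"
    using T unfolding Phi_eq_Some_iff eval_iff_least_certificate by metis
  obtain v where v: "\<And>n. least_certificate (pair_baire (\<lambda>k. u (k + 2)) q) (u 1) n (y n) (v n)"
    using y unfolding Phi_eq_Some_iff eval_iff_least_certificate by metis
  define h where "h n = prod_encode (char_tree T n, prod_encode (w n, prod_encode (q n,
    prod_encode (y n, v n))))" for n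
  have "char_tree T n = 1" if "list_decode n = map q [0..<length (list_decode n)]" for n
    using q that unfolding mem_paths_iff_char_tree by (metis list_decode_inverse)
  then have "h \<in> paths (solution_tree u)"
    unfolding mem_paths_solution_tree using w v by (simp add: h_def)
  moreover have "(\<lambda>n. solution_at (h n)) = q" by (simp add: h_def)
  ultimately show ?thesis by blast
qed

text \<open>
  Evaluation is deterministic and least certificates are unique, so by \<open>mem_paths_solution_tree\<close>
  the solution component determines the other four.
\<close>

lemma solution_tree_path_unique:
  assumes h: "h \<in> paths (solution_tree u)" and h': "h' \<in> paths (solution_tree u)"
    and eq: "(\<lambda>n. solution_at (h n)) = (\<lambda>n. solution_at (h' n))"
  shows "h = h'"
proof
  fix n
  note h = h[unfolded mem_paths_solution_tree, rule_format, of n]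
    and h' = h'[unfolded mem_paths_solution_tree, folded eq, rule_format, of n]
  have v: "value_at (h n) = value_at (h' n)"
    using h h' eval_iff_least_certificate eval_deterministic by blast
  then have w: "value_cert (h n) = value_cert (h' n)"
    using h h' least_certificate_unique by metis
  have y: "output_at (h n) = output_at (h' n)"
    using h h' eval_iff_least_certificate eval_deterministic by blast
  then have "output_cert (h n) = output_cert (h' n)"
    using h h' least_certificate_unique by metis
  with v w y fun_cong[OF eq, of n] show "h n = h' n"
    by (metis prod.collapse prod_decode_inverse)
qed

section \<open>The reductions\<close>

lemma totalization_nonempty: "x \<in> pdom (totalization f)"
  by (simp add: pdom_def totalization_def)

lemma totalization_le_tJ: "totalization f \<le>\<^sub>W tJ f"
proof -
  obtain e where e: "\<And>p. Phi e p = Some p"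
    using partial_computable_total[OF computable_oracle_at[OF computable_id]]
    unfolding partial_computable_def by metis
  have "computable (\<lambda>r n. r (Suc (n + n)))" by (intro computable_intros)
  from partial_computable_total[OF this]
  obtain i where i: "\<And>r. Phi i r = Some (\<lambda>n. r (Suc (n + n)))"
    unfolding partial_computable_def by metis
  have snd: "(\<lambda>n. pair_baire p q (Suc (n + n))) = q" for p q
    by (simp add: pair_baire_def flip: mult_2)
  have tJ: "tJ f (triple_baire e i p) = totalization f p" for p
    unfolding tJ_triple_baire
    by (auto simp: tot_jump_at_def totalization_def e i snd)
  show ?thesis
  proof (rule weihrauch_le_totalI)
    have "computable (\<lambda>u n. if n = 0 then e else if n = 1 then i else u (n - 2))"
      by (intro computable_intros)
    moreover have "(if n = 0 then e else if n = 1 then i else u (n - 2)) = triple_baire e i u n"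
      for u n by (auto simp: triple_baire_def numeral_2_eq_2 split: nat.split)
    ultimately show "computable (triple_baire e i)" by (simp only:)
    show "computable (\<lambda>r n. r (Suc (n + n)))" by (intro computable_intros)
    show "triple_baire e i p \<in> pdom (tJ f)" for p
      using totalization_nonempty[of p f] by (simp add: pdom_def tJ)
    show "(\<lambda>n. pair_baire p q (Suc (n + n))) \<in> totalization f p"
      if "q \<in> tJ f (triple_baire e i p)" for p q
      using that unfolding tJ snd .
  qed
qed

text \<open>
  Choice and unique choice are treated together. Both return all paths of the given tree, and
  whether a tree is a legal input depends only on the number of its paths: this is the second
  assumption.
\<close>

lemma tJ_le_totalization:
  assumes dom: "\<And>x. f x \<noteq> {} \<Longrightarrow> \<exists>T. is_tree T \<and> x = char_tree T \<and> f x = paths T"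
    and transfer: "\<And>S T g. is_tree S \<Longrightarrow> is_tree T \<Longrightarrow> f (char_tree T) \<noteq> {} \<Longrightarrow>
      bij_betw g (paths S) (paths T) \<Longrightarrow> f (char_tree S) = paths S"
  shows "tJ f \<le>\<^sub>W totalization f"
proof (rule weihrauch_le_totalI)
  show "computable (\<lambda>u. char_tree (solution_tree u))" by (rule computable_solution_tree)
  show "computable (\<lambda>r n. output_at (r (Suc (n + n))))" by (intro computable_intros)
  show "char_tree (solution_tree u) \<in> pdom (totalization f)" for u by (rule totalization_nonempty)
  fix u h
  assume h: "h \<in> totalization f (char_tree (solution_tree u))"
  define p where "p = (\<lambda>k. u (k + 2))"
  have out: "(\<lambda>n. output_at (pair_baire u h (Suc (n + n)))) = (\<lambda>n. output_at (h n))"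
    by (simp add: pair_baire_def flip: mult_2)
  show "(\<lambda>n. output_at (pair_baire u h (Suc (n + n)))) \<in> tJ f u"
  proof (cases "\<exists>x. Phi (u 0) p = Some x \<and> x \<in> pdom f \<and>
      (\<forall>q\<in>f x. Phi (u 1) (pair_baire p q) \<noteq> None)")
    case False
    then have "tJ f u = UNIV" unfolding tJ_def tot_jump_at_def p_def by (rule if_not_P)
    then show ?thesis by simp
  next
    case True
    then obtain x where x: "Phi (u 0) p = Some x" "f x \<noteq> {}"
      and y: "\<forall>q\<in>f x. \<exists>y. Phi (u 1) (pair_baire p q) = Some y"
      by (auto simp: pdom_def)
    from dom[OF x(2)] obtain T where T: "is_tree T" "x = char_tree T" "f x = paths T" by blast
    let ?S = "paths (solution_tree u)" and ?g = "\<lambda>h n. solution_at (h n)"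
    note x' = x(1)[unfolded T(2) p_def]
    have "bij_betw ?g ?S (paths T)"
      unfolding bij_betw_def
    proof
      show "inj_on ?g ?S" by (rule inj_onI) (rule solution_tree_path_unique)
      show "?g ` ?S = paths T"
        using solution_tree_path_sound(1)[OF _ x'] solution_tree_path_complete[OF _ x']
          y[unfolded T(3) p_def] by fast
    qed
    then have fS: "f (char_tree (solution_tree u)) = ?S" and ne: "?S \<noteq> {}"
      using transfer[OF is_tree_solution_tree T(1)] x(2) T(2,3) by (auto simp: bij_betw_def)
    from h ne have "h \<in> ?S" by (simp add: totalization_def pdom_def fS)
    note sound = solution_tree_path_sound[OF this x', folded p_def]
    have "tJ f u = {the (Phi (u 1) (pair_baire p q)) | q. q \<in> f (the (Phi (u 0) p))}"
      using True unfolding tJ_def tot_jump_at_def p_def by (rule if_P)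
    then show ?thesis unfolding out using sound x(1) T(3) by force
  qed
qed

theorem theorem4p18:
  "tJ UC_Baire \<equiv>\<^sub>W totalization UC_Baire \<and> tJ C_Baire \<equiv>\<^sub>W totalization C_Baire"
proof -
  have "tJ C_Baire \<le>\<^sub>W totalization C_Baire"
  proof (rule tJ_le_totalization)
    show "\<exists>T. is_tree T \<and> x = char_tree T \<and> C_Baire x = paths T" if "C_Baire x \<noteq> {}" for x
      using that C_Baire_char_tree by (auto simp: C_Baire_def)
  qed (rule C_Baire_char_tree)
  moreover have "tJ UC_Baire \<le>\<^sub>W totalization UC_Baire"
  proof (rule tJ_le_totalization)
    fix x assume ne: "UC_Baire x \<noteq> {}"
    then have "UC_Baire x = C_Baire x" "C_Baire x \<noteq> {}" by (auto simp: UC_Baire_def split: if_splits)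
    then show "\<exists>T. is_tree T \<and> x = char_tree T \<and> UC_Baire x = paths T"
      using C_Baire_char_tree by (auto simp: C_Baire_def)
  next
    fix S T :: "nat list set" and g :: "baire \<Rightarrow> baire"
    assume S: "is_tree S" and T: "is_tree T" "UC_Baire (char_tree T) \<noteq> {}"
      and g: "bij_betw g (paths S) (paths T)"
    from T have "\<exists>!h. h \<in> paths T" by (simp add: UC_Baire_char_tree split: if_splits)
    then obtain h where "paths T = {h}" by blast
    with g have "is_singleton (paths S)"
      by (metis bij_betw_same_card card_1_singleton_iff is_singleton_altdef One_nat_def)
    then have "\<exists>!h. h \<in> paths S" by (auto simp: is_singleton_def)
    then show "UC_Baire (char_tree S) = paths S" by (simp add: UC_Baire_char_tree S)
  qed
  ultimately show ?thesis
    by (simp add: weihrauch_equiv_def totalization_le_tJ)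
qed

end
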